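(* For a positive rational number $r$, put $r^{\flat}:=\dfrac{1}{\operatorname{lcm}(\operatorname{den}(r),2)}$. Then: (1) For every positive rational number $r$ and every integer $k\geq 1$, $$\mathcal{T}_{r^{\flat},k}(q)\succeq_q \mathcal{T}_{r,k}(q).$$ (2) Consequently, the statement "$\mathcal{T}_{1/2,k}(q)\succeq_q\mathcal{T}_{r,k}(q)$ for every positive rational number $r$ and every integer $k\geq 1$" is equivalent to the statement "$\mathcal{T}_{1/2,k}(q)\succeq_q\mathcal{T}_{1/(2m),k}(q)$ for all integers $m\geq 1$ and $k\geq 1$". (3) Moreover, for each fixed integer $k\geq 1$ it suffices to verify the latter family in a finite range of $m$: if $\mathcal{T}_{1/2,k}(q)\succeq_q\mathcal{T}_{1/(2m),k}(q)$ for every integer $m$ with $2\leq m\leq\lfloor k/2\rfloor$, then $\mathcal{T}_{1/2,k}(q)\succeq_q\mathcal{T}_{1/(2m),k}(q)$ for every integer $m\geq 1$.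
   Context: For a positive rational $x$, $\operatorname{den}(x)$ denotes the denominator of $x$ in lowest terms. For $n\ge 0$, $(z;q)_n:=\prod_{j=0}^{n-1}(1-zq^j)$, with $(z;q)_0:=1$. Let $\mathcal{P}:=\bigcup_{M\geq 1}\mathbb{Q}[[q^{1/M}]]$ be the directed union of the rings of fractional power series (exponents are nonnegative rationals with a common denominator). If $F(q)=\sum_{\alpha\in\frac1M\mathbb{Z}_{\ge0}}c(\alpha)q^\alpha\in\mathcal{P}$, its integer trace is $\operatorname{Tr}_{\mathbb{Z}}(F):=\sum_{n\geq 0}c(n)q^n\in\mathbb{Q}[[q]]$, the sum running over integers $n\ge 0$ (all terms with non-integer exponent are discarded). For a positive rational number $r$ and an integer $k\geq 0$, set $$G_{r,k}(q):=\frac{(q^{r+1};q)_k}{(q;q)_k}\in\mathcal{P},\qquad \mathcal{T}_{r,k}(q):=\operatorname{Tr}_{\mathbb{Z}}(G_{r,k}(q))\in\mathbb{Z}[[q]].$$ For $F,G\in\mathbb{Q}[[q]]$, write $F\succeq_q G$ if for every integer $n\geq 0$ the coefficient of $q^n$ in $F-G$ is $\geq 0$. *)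

theory Defs
  imports Complex_Main "HOL-Computational_Algebra.Formal_Power_Series"
begin

text \<open>A fractional power series is represented by its coefficient function on the rationals.\<close>

typedef frac_fps =
  "{c :: rat \<Rightarrow> rat. \<exists>M::nat. M \<ge> 1 \<and>
      (\<forall>\<alpha>. c \<alpha> \<noteq> 0 \<longrightarrow> (\<exists>i::nat. \<alpha> = of_nat i / of_nat M))}"
  morphisms frac_nth Abs_frac_fps
  by (rule exI[of _ "\<lambda>_. 0"]) auto

setup_lifting type_definition_frac_fps

lemma frac_fps_eqI: "(\<And>\<alpha>. frac_nth F \<alpha> = frac_nth G \<alpha>) \<Longrightarrow> F = G"
  by (metis frac_nth_inject ext)

text \<open>For \<open>M \<ge> 1\<close>, \<open>frac_of_fps M f\<close> is \<open>f(q\<^sup>1\<^sup>/\<^sup>M)\<close>; ring identities are transported along it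
  from \<^typ>\<open>rat fps\<close>.\<close>

lift_definition frac_of_fps :: "nat \<Rightarrow> rat fps \<Rightarrow> frac_fps" is
  "\<lambda>M f \<alpha>. if M \<ge> 1 \<and> (\<exists>i::nat. \<alpha> = of_nat i / of_nat M)
            then fps_nth f (nat \<lfloor>of_nat M * \<alpha>\<rfloor>) else 0"
  subgoal for M f by (cases "M \<ge> 1") (auto intro: exI[of _ M] exI[of _ 1])
  done

lemma frac_of_fps_nth:
  "M \<ge> 1 \<Longrightarrow> frac_nth (frac_of_fps M f) (of_nat i / of_nat M) = fps_nth f i"
  by transfer auto

lemma frac_of_fps_nth_0:
  "(\<And>i::nat. \<alpha> \<noteq> of_nat i / of_nat M) \<Longrightarrow> frac_nth (frac_of_fps M f) \<alpha> = 0"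
  by transfer auto

lemma frac_of_fps_eqI:
  assumes "M \<ge> 1" "\<And>i. frac_nth F (of_nat i / of_nat M) = fps_nth f i"
    "\<And>\<alpha>. (\<And>i::nat. \<alpha> \<noteq> of_nat i / of_nat M) \<Longrightarrow> frac_nth F \<alpha> = 0"
  shows "F = frac_of_fps M f"
proof (rule frac_fps_eqI)
  fix \<alpha> show "frac_nth F \<alpha> = frac_nth (frac_of_fps M f) \<alpha>"
  proof (cases "\<exists>i::nat. \<alpha> = of_nat i / of_nat M")
    case True
    then show ?thesis using assms(1,2) frac_of_fps_nth by auto
  next
    case False
    then show ?thesis using assms(3) frac_of_fps_nth_0 by auto
  qed
qed

lemma ex_frac_of_fps:
  "\<exists>M\<ge>1. \<forall>N\<ge>1. \<exists>f. F = frac_of_fps (M * N) f"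
proof -
  obtain M :: nat where M: "M \<ge> 1"
    and supp: "\<And>\<alpha>. frac_nth F \<alpha> \<noteq> 0 \<Longrightarrow> \<exists>i::nat. \<alpha> = of_nat i / of_nat M"
    using frac_nth[of F] by auto
  have "\<exists>f. F = frac_of_fps (M * N) f" if N: "N \<ge> 1" for N
  proof -
    have "F = frac_of_fps (M * N) (Abs_fps (\<lambda>i. frac_nth F (of_nat i / of_nat (M * N))))"
    proof (rule frac_of_fps_eqI)
      show "M * N \<ge> 1" using M N by simp
      fix \<alpha> :: rat assume *: "\<And>i::nat. \<alpha> \<noteq> of_nat i / of_nat (M * N)"
      show "frac_nth F \<alpha> = 0"
      proof (rule ccontr)
        assume "frac_nth F \<alpha> \<noteq> 0"
        then obtain i :: nat where "\<alpha> = of_nat i / of_nat M" using supp by auto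
        then have "\<alpha> = of_nat (i * N) / of_nat (M * N)" using N by simp
        then show False using * by blast
      qed
    qed simp
    then show ?thesis ..
  qed
  then show ?thesis using M by auto
qed

lemma common_frac_of_fps:
  obtains M f g h where "M \<ge> 1" "F = frac_of_fps M f" "G = frac_of_fps M g" "H = frac_of_fps M h"
proof -
  obtain A where A: "A \<ge> 1" "\<And>N. N \<ge> 1 \<Longrightarrow> \<exists>f. F = frac_of_fps (A * N) f"
    using ex_frac_of_fps[of F] by auto
  obtain B where B: "B \<ge> 1" "\<And>N. N \<ge> 1 \<Longrightarrow> \<exists>f. G = frac_of_fps (B * N) f"
    using ex_frac_of_fps[of G] by auto
  obtain C where C: "C \<ge> 1" "\<And>N. N \<ge> 1 \<Longrightarrow> \<exists>f. H = frac_of_fps (C * N) f"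
    using ex_frac_of_fps[of H] by auto
  have "B * C \<ge> 1" "A * C \<ge> 1" "A * B \<ge> 1" "A * B * C \<ge> 1"
    using A(1) B(1) C(1) by (simp_all add: Suc_le_eq)
  moreover have "A * (B * C) = A * B * C" "B * (A * C) = A * B * C" "C * (A * B) = A * B * C"
    by (simp_all add: ac_simps)
  ultimately show ?thesis using that A(2)[of "B * C"] B(2)[of "A * C"] C(2)[of "A * B"] by metis
qed

lemma frac_fps_support:
  obtains M :: nat where "M \<ge> 1"
    "\<And>\<alpha>. frac_nth F \<alpha> \<noteq> 0 \<Longrightarrow> \<exists>i::nat. \<alpha> = of_nat i / of_nat M"
    "\<And>\<alpha>. frac_nth G \<alpha> \<noteq> 0 \<Longrightarrow> \<exists>i::nat. \<alpha> = of_nat i / of_nat M"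
proof -
  obtain M f g h where "M \<ge> 1" "F = frac_of_fps M f" "G = frac_of_fps M g" "G = frac_of_fps M h"
    by (rule common_frac_of_fps[of F G G])
  then show ?thesis using that[of M] frac_of_fps_nth_0 by metis
qed

lemma grid_add:
  "\<exists>i::nat. \<alpha> = of_nat i / of_nat M \<Longrightarrow> \<exists>i::nat. \<beta> = of_nat i / of_nat M \<Longrightarrow>
   \<exists>i::nat. \<alpha> + \<beta> = (of_nat i / of_nat M :: rat)"
  by (metis add_divide_distrib of_nat_add)

instantiation frac_fps :: "{zero, one, plus, minus, uminus, times}"
begin

lift_definition zero_frac_fps :: frac_fps is "\<lambda>_. 0"
  by (auto intro: exI[of _ 1])

lift_definition one_frac_fps :: frac_fps is "\<lambda>\<alpha>. if \<alpha> = 0 then 1 else 0"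
  by (rule exI[of _ 1]) auto

lift_definition uminus_frac_fps :: "frac_fps \<Rightarrow> frac_fps" is "\<lambda>a \<alpha>. - a \<alpha>"
  by auto

definition plus_frac_fps :: "frac_fps \<Rightarrow> frac_fps \<Rightarrow> frac_fps" where
  "F + G = Abs_frac_fps (\<lambda>\<alpha>. frac_nth F \<alpha> + frac_nth G \<alpha>)"

definition minus_frac_fps :: "frac_fps \<Rightarrow> frac_fps \<Rightarrow> frac_fps" where
  "F - G = F + (- G)" for F G :: frac_fps

text \<open>The index set of the convolution is finite because both supports lie in some
  \<open>(1/M) \<nat>\<close>.\<close>

definition times_frac_fps :: "frac_fps \<Rightarrow> frac_fps \<Rightarrow> frac_fps" where
  "F * G = Abs_frac_fps (\<lambda>\<alpha>. \<Sum>\<beta> | frac_nth F \<beta> \<noteq> 0 \<and> frac_nth G (\<alpha> - \<beta>) \<noteq> 0.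
     frac_nth F \<beta> * frac_nth G (\<alpha> - \<beta>))"

instance ..

end

lemma frac_nth_add: "frac_nth (F + G) \<alpha> = frac_nth F \<alpha> + frac_nth G \<alpha>"
proof -
  obtain M :: nat where "M \<ge> 1"
    "\<And>\<alpha>. frac_nth F \<alpha> \<noteq> 0 \<Longrightarrow> \<exists>i::nat. \<alpha> = of_nat i / of_nat M"
    "\<And>\<alpha>. frac_nth G \<alpha> \<noteq> 0 \<Longrightarrow> \<exists>i::nat. \<alpha> = of_nat i / of_nat M"
    using frac_fps_support[of F G] by blast
  then have "\<forall>\<alpha>. frac_nth F \<alpha> + frac_nth G \<alpha> \<noteq> 0 \<longrightarrow> (\<exists>i::nat. \<alpha> = of_nat i / of_nat M)"
    by (metis add.right_neutral)
  then have "(\<lambda>\<alpha>. frac_nth F \<alpha> + frac_nth G \<alpha>) \<in>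
     {c. \<exists>M::nat. M \<ge> 1 \<and> (\<forall>\<alpha>. c \<alpha> \<noteq> 0 \<longrightarrow> (\<exists>i::nat. \<alpha> = of_nat i / of_nat M))}"
    using \<open>M \<ge> 1\<close> by blast
  then show ?thesis unfolding plus_frac_fps_def by (simp add: Abs_frac_fps_inverse)
qed

lemma frac_nth_mult:
  "frac_nth (F * G) \<alpha> = (\<Sum>\<beta> | frac_nth F \<beta> \<noteq> 0 \<and> frac_nth G (\<alpha> - \<beta>) \<noteq> 0.
     frac_nth F \<beta> * frac_nth G (\<alpha> - \<beta>))"
proof -
  let ?S = "\<lambda>\<alpha>. {\<beta>. frac_nth F \<beta> \<noteq> 0 \<and> frac_nth G (\<alpha> - \<beta>) \<noteq> 0}"
  let ?c = "\<lambda>\<alpha>. \<Sum>\<beta>\<in>?S \<alpha>. frac_nth F \<beta> * frac_nth G (\<alpha> - \<beta>)"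
  obtain M :: nat where M: "M \<ge> 1"
    and F: "\<And>\<alpha>. frac_nth F \<alpha> \<noteq> 0 \<Longrightarrow> \<exists>i::nat. \<alpha> = of_nat i / of_nat M"
    and G: "\<And>\<alpha>. frac_nth G \<alpha> \<noteq> 0 \<Longrightarrow> \<exists>i::nat. \<alpha> = of_nat i / of_nat M"
    using frac_fps_support[of F G] by blast
  have "\<exists>i::nat. \<alpha> = of_nat i / of_nat M" if "?c \<alpha> \<noteq> 0" for \<alpha>
  proof -
    from that have "?S \<alpha> \<noteq> {}" by (metis sum.empty)
    then obtain \<beta> where "frac_nth F \<beta> \<noteq> 0" "frac_nth G (\<alpha> - \<beta>) \<noteq> 0"
      by blast
    then show ?thesis using grid_add[OF F G, of \<beta> "\<alpha> - \<beta>"] by simp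
  qed
  then have "?c \<in> {c. \<exists>M::nat. M \<ge> 1 \<and> (\<forall>\<alpha>. c \<alpha> \<noteq> 0 \<longrightarrow> (\<exists>i::nat. \<alpha> = of_nat i / of_nat M))}"
    using M by blast
  then show ?thesis unfolding times_frac_fps_def by (simp add: Abs_frac_fps_inverse)
qed

lemma frac_of_fps_0: "M \<ge> 1 \<Longrightarrow> frac_of_fps M 0 = 0"
  by (rule frac_of_fps_eqI[symmetric]) (simp_all add: zero_frac_fps.rep_eq)

lemma frac_of_fps_1:
  assumes "M \<ge> 1" shows "frac_of_fps M 1 = 1"
proof (rule frac_of_fps_eqI[symmetric])
  fix \<alpha> :: rat assume "\<And>i::nat. \<alpha> \<noteq> of_nat i / of_nat M"
  from this[of 0] show "frac_nth 1 \<alpha> = 0" by (simp add: one_frac_fps.rep_eq)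
qed (use assms in \<open>auto simp: one_frac_fps.rep_eq\<close>)

lemma frac_of_fps_add:
  "M \<ge> 1 \<Longrightarrow> frac_of_fps M (f + g) = frac_of_fps M f + frac_of_fps M g"
  by (rule frac_of_fps_eqI[symmetric])
     (simp_all add: frac_nth_add frac_of_fps_nth frac_of_fps_nth_0)

lemma frac_of_fps_uminus:
  "M \<ge> 1 \<Longrightarrow> frac_of_fps M (- f) = - frac_of_fps M f"
  by (rule frac_of_fps_eqI[symmetric])
     (simp_all add: uminus_frac_fps.rep_eq frac_of_fps_nth frac_of_fps_nth_0)

lemma frac_of_fps_mult:
  assumes M: "M \<ge> 1"
  shows "frac_of_fps M (f * g) = frac_of_fps M f * frac_of_fps M g"
proof (rule frac_of_fps_eqI[symmetric, OF M])
  let ?F = "frac_nth (frac_of_fps M f)" and ?G = "frac_nth (frac_of_fps M g)"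
  let ?e = "\<lambda>i::nat. of_nat i / of_nat M :: rat"
  have F: "\<exists>i. \<alpha> = ?e i" if "?F \<alpha> \<noteq> 0" for \<alpha> using that frac_of_fps_nth_0 by blast
  have G: "\<exists>i. \<alpha> = ?e i" if "?G \<alpha> \<noteq> 0" for \<alpha> using that frac_of_fps_nth_0 by blast
  have inj: "inj_on ?e A" for A using M by (auto simp: inj_on_def)
  have diff: "?e n - ?e i = ?e (n - i)" if "i \<le> n" for i n
    using that by (simp add: of_nat_diff diff_divide_distrib)
  {
    fix n
    have "{\<beta>. ?F \<beta> \<noteq> 0 \<and> ?G (?e n - \<beta>) \<noteq> 0} \<subseteq> ?e ` {0..n}"
    proof clarify
      fix \<beta> assume "?F \<beta> \<noteq> 0" "?G (?e n - \<beta>) \<noteq> 0"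
      then obtain i j where ij: "\<beta> = ?e i" "?e n - \<beta> = ?e j" using F G by blast
      then have "?e n = ?e (i + j)" by (simp add: add_divide_distrib)
      then have "n = i + j" using inj[of UNIV] by (auto dest: injD)
      then show "\<beta> \<in> ?e ` {0..n}" using ij by auto
    qed
    then have "frac_nth (frac_of_fps M f * frac_of_fps M g) (?e n) =
        (\<Sum>\<beta>\<in>?e ` {0..n}. ?F \<beta> * ?G (?e n - \<beta>))"
      unfolding frac_nth_mult by (intro sum.mono_neutral_left) auto
    also have "\<dots> = (\<Sum>i=0..n. ?F (?e i) * ?G (?e n - ?e i))"
      by (simp add: sum.reindex[OF inj])
    also have "\<dots> = fps_nth (f * g) n"
      unfolding fps_mult_nth
    proof (rule sum.cong)
      fix i assume "i \<in> {0..n}"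
      then have "?e n - ?e i = ?e (n - i)" by (intro diff) simp
      then show "?F (?e i) * ?G (?e n - ?e i) = fps_nth f i * fps_nth g (n - i)"
        using frac_of_fps_nth[OF M] by metis
    qed simp
    finally show "frac_nth (frac_of_fps M f * frac_of_fps M g) (?e n) = fps_nth (f * g) n" .
  }
  fix \<alpha> assume *: "\<And>i. \<alpha> \<noteq> ?e i"
  have "{\<beta>. ?F \<beta> \<noteq> 0 \<and> ?G (\<alpha> - \<beta>) \<noteq> 0} = {}"
  proof safe
    fix \<beta> assume "?F \<beta> \<noteq> 0" "?G (\<alpha> - \<beta>) \<noteq> 0"
    then show "\<beta> \<in> {}" using grid_add[OF F G, of \<beta> "\<alpha> - \<beta>"] * by simp
  qed
  then show "frac_nth (frac_of_fps M f * frac_of_fps M g) \<alpha> = 0"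
    unfolding frac_nth_mult by (metis sum.empty)
qed

instance frac_fps :: comm_ring_1
proof
  fix a b c :: frac_fps
  obtain M f g h where M: "M \<ge> 1"
    and e: "a = frac_of_fps M f" "b = frac_of_fps M g" "c = frac_of_fps M h"
    by (rule common_frac_of_fps[of a b c])
  note hom = frac_of_fps_0[OF M, symmetric] frac_of_fps_1[OF M, symmetric]
    frac_of_fps_add[OF M, symmetric] frac_of_fps_uminus[OF M, symmetric]
    frac_of_fps_mult[OF M, symmetric]
  show "a * b * c = a * (b * c)" "a * b = b * a" "1 * a = a" "a + b + c = a + (b + c)"
    "a + b = b + a" "0 + a = a" "- a + a = 0" "(a + b) * c = a * c + b * c"
    unfolding e hom by (simp_all add: algebra_simps)
  show "a - b = a + - b" by (simp add: minus_frac_fps_def)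
  have "frac_nth 0 0 \<noteq> frac_nth 1 0" by (simp add: zero_frac_fps.rep_eq one_frac_fps.rep_eq)
  then show "(0::frac_fps) \<noteq> 1" by metis
qed

text \<open>Non-units get the inverse \<open>0\<close>.\<close>

instantiation frac_fps :: inverse
begin

definition inverse_frac_fps :: "frac_fps \<Rightarrow> frac_fps" where
  "inverse F = (if F dvd 1 then THE H. F * H = 1 else 0)" for F :: frac_fps

definition divide_frac_fps :: "frac_fps \<Rightarrow> frac_fps \<Rightarrow> frac_fps" where
  "F div G = F * inverse G" for F G :: frac_fps

instance ..

end

lemma frac_fps_inverse_eqI:
  fixes F H :: frac_fps
  assumes "F * H = 1" shows "inverse F = H"
proof -
  have "(THE H. F * H = 1) = H"
  proof (rule the_equality)
    show "F * H = 1" by (rule assms)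
    fix K assume "F * K = 1"
    then show "K = H" using assms by (metis mult.assoc mult.commute mult_1)
  qed
  moreover have "F dvd 1" using assms by (metis dvd_triv_left)
  ultimately show ?thesis unfolding inverse_frac_fps_def by simp
qed

text \<open>\<open>q_powr \<alpha>\<close> is the monomial with exponent \<open>\<alpha>\<close>, for \<open>\<alpha> \<ge> 0\<close>; a negative exponent gives \<open>0\<close>.\<close>

lift_definition q_powr :: "rat \<Rightarrow> frac_fps" is
  "\<lambda>\<alpha> \<beta>. if \<alpha> \<ge> 0 \<and> \<beta> = \<alpha> then 1 else 0"
proof -
  fix \<alpha> :: rat
  obtain a b where ab: "quotient_of \<alpha> = (a, b)" by force
  then have b: "b > 0" and eq: "\<alpha> = of_int a / of_int b"
    using quotient_of_denom_pos quotient_of_div by auto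
  have "\<alpha> = of_nat (nat a) / of_nat (nat b)" if "\<alpha> \<ge> 0"
    using that b unfolding eq by (simp add: zero_le_divide_iff)
  moreover have "nat b \<ge> 1" using b by linarith
  ultimately show "\<exists>M::nat. M \<ge> 1 \<and>
      (\<forall>\<beta>. (if \<alpha> \<ge> 0 \<and> \<beta> = \<alpha> then 1 else 0 :: rat) \<noteq> 0 \<longrightarrow> (\<exists>i::nat. \<beta> = of_nat i / of_nat M))"
    by (intro exI[of _ "nat b"]) (metis (full_types))
qed

definition q_pochhammer :: "'a::comm_ring_1 \<Rightarrow> 'a \<Rightarrow> nat \<Rightarrow> 'a" where
  "q_pochhammer z q n = (\<Prod>j<n. 1 - z * q ^ j)"

lemma q_powr_1: "q_powr 1 = frac_of_fps 1 fps_X"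
proof (rule frac_of_fps_eqI)
  fix \<alpha> :: rat assume "\<And>i::nat. \<alpha> \<noteq> of_nat i / of_nat 1"
  from this[of 1] show "frac_nth (q_powr 1) \<alpha> = 0" by (simp add: q_powr.rep_eq)
qed (auto simp: q_powr.rep_eq fps_X_def)

text \<open>The denominator of \<open>G_frac\<close> below is a unit, so the quotient is the true one.\<close>

lemma q_pochhammer_q_q_unit:
  "q_pochhammer (q_powr 1) (q_powr 1) k * inverse (q_pochhammer (q_powr 1) (q_powr 1) k) = 1"
proof -
  have "\<exists>f. fps_nth f 0 = 1 \<and> q_pochhammer (q_powr 1) (q_powr 1) k = frac_of_fps 1 f"
  proof (induction k)
    case 0
    show ?case by (intro exI[of _ 1]) (simp add: q_pochhammer_def frac_of_fps_1)
  next
    case (Suc k)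
    then obtain f where f: "fps_nth f 0 = 1"
      "q_pochhammer (q_powr 1) (q_powr 1) k = frac_of_fps 1 f" by auto
    have pow: "frac_of_fps 1 fps_X ^ n = frac_of_fps 1 (fps_X ^ n)" for n
      by (induction n) (simp_all add: frac_of_fps_1 frac_of_fps_mult)
    have sub: "frac_of_fps 1 (g - h) = frac_of_fps 1 g - frac_of_fps 1 h" for g h
      using frac_of_fps_add[of 1 g "- h"] frac_of_fps_uminus[of 1 h] by simp
    have "q_pochhammer (q_powr 1) (q_powr 1) (Suc k) = frac_of_fps 1 (f * (1 - fps_X * fps_X ^ k))"
      using f(2) by (simp add: q_pochhammer_def frac_of_fps_mult sub frac_of_fps_1
          q_powr_1 pow del: power_Suc One_nat_def)
    moreover have "fps_nth (f * (1 - fps_X * fps_X ^ k)) 0 = 1" using f(1) by simp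
    ultimately show ?case by blast
  qed
  then obtain f where f: "fps_nth f 0 = 1"
    "q_pochhammer (q_powr 1) (q_powr 1) k = frac_of_fps 1 f" by auto
  have "frac_of_fps 1 f * frac_of_fps 1 (inverse f) = 1"
    using f(1) inverse_mult_eq_1'[of f] by (simp add: frac_of_fps_1 flip: frac_of_fps_mult)
  then show ?thesis using f(2) frac_fps_inverse_eqI by simp
qed

definition integer_trace :: "frac_fps \<Rightarrow> rat fps" where
  "integer_trace F = Abs_fps (\<lambda>n. frac_nth F (of_nat n))"

definition G_frac :: "rat \<Rightarrow> nat \<Rightarrow> frac_fps" where
  "G_frac r k = q_pochhammer (q_powr (r + 1)) (q_powr 1) k / q_pochhammer (q_powr 1) (q_powr 1) k"

definition T_trace :: "rat \<Rightarrow> nat \<Rightarrow> rat fps" where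
  "T_trace r k = integer_trace (G_frac r k)"

definition coeff_ge :: "rat fps \<Rightarrow> rat fps \<Rightarrow> bool"  (infix "\<succeq>\<^sub>q" 50) where
  "F \<succeq>\<^sub>q G \<longleftrightarrow> (\<forall>n. fps_nth (F - G) n \<ge> 0)"

definition den :: "rat \<Rightarrow> int" where
  "den x = snd (quotient_of x)"

definition flat :: "rat \<Rightarrow> rat" where
  "flat r = 1 / of_int (lcm (den r) 2)"

end

theory Submission imports Defs begin

text \<open>By the \<open>q\<close>-binomial theorem,
  \<open>G\<^bsub>r,k\<^esub>(q) = \<Sum>\<^bsub>j \<le> k\<^esub> (-1)\<^sup>j q\<^bsup>j(j+1)/2 + rj\<^esup> / ((q;q)\<^sub>j (q;q)\<^bsub>k-j\<^esub>)\<close>,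
  and the integer trace keeps exactly the terms with \<open>rj \<in> \<int>\<close>. Such a term with \<open>j\<close> odd is
  nonpositive, and it is absent from the trace for \<open>r\<^sup>\<flat>\<close>. If \<open>j\<close> is even and
  \<open>rj \<in> \<int>\<close>, then \<open>r\<^sup>\<flat>j \<in> \<int>\<close> and \<open>r\<^sup>\<flat>j \<le> rj\<close>; for \<open>j \<ge> 1\<close> the factor \<open>1/(1-q)\<close> makes the
  coefficients of \<open>1 / ((q;q)\<^sub>j (q;q)\<^bsub>k-j\<^esub>)\<close> nondecreasing, so lowering the exponent increases
  the term. If \<open>2m > k\<close>, only \<open>j = 0\<close> contributes to the trace for \<open>1/(2m)\<close>, and this term occurs
  in the trace for \<open>1/2\<close>, whose other terms are nonnegative.\<close>

section \<open>The q-binomial theorem\<close>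

text \<open>Both sides obey the same first-order recurrence in k. The abstract inverses
  \<open>u\<close> of (q;q)_n make the identity available in any commutative ring, in particular for
  fractional power series.\<close>

lemma q_binomial_unit:
  fixes q z :: "'a::comm_ring_1" and u :: "nat \<Rightarrow> 'a"
  assumes u: "\<And>n. q_pochhammer q q n * u n = 1"
  shows "q_pochhammer (z * q) q k * u k =
    (\<Sum>j\<le>k. (-1) ^ j * q ^ (Suc j choose 2) * z ^ j * (u j * u (k - j)))"
proof -
  define a where "a j = (-1) ^ j * q ^ (Suc j choose 2) * z ^ j" for j
  define S where "S k = (\<Sum>j\<le>k. a j * (u j * u (k - j)))" for k
  have poch_Suc: "q_pochhammer x q (Suc n) = q_pochhammer x q n * (1 - x * q ^ n)" for x n
    by (simp add: q_pochhammer_def)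
  have a_Suc: "a (Suc i) = - (a i * q ^ Suc i * z)" for i
    by (simp add: a_def numeral_2_eq_2 power_add algebra_simps)
  have u_Suc: "(1 - q ^ Suc n) * u (Suc n) = u n" for n
  proof -
    have "u n = u n * (q_pochhammer q q (Suc n) * u (Suc n))" by (simp add: u)
    also have "\<dots> = (q_pochhammer q q n * u n) * ((1 - q ^ Suc n) * u (Suc n))"
      by (simp add: poch_Suc ac_simps)
    finally show ?thesis by (simp add: u)
  qed
  have step: "(1 - q ^ Suc k) * S (Suc k) = (1 - z * q ^ Suc k) * S k" for k
  proof -
    \<comment> \<open>Uses 1 - q^(k+1) = (1 - q^(k+1-j)) + q^(k+1-j) * (1 - q^j): the first bracket
      lowers the index of \<open>u (Suc k - j)\<close>, the second that of \<open>u j\<close>.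
      \<open>?f\<close> vanishes at j = k+1 and \<open>?g\<close> at j = 0.\<close>
    let ?f = "\<lambda>j. a j * (u j * ((1 - q ^ (Suc k - j)) * u (Suc k - j)))"
    let ?g = "\<lambda>j. a j * q ^ (Suc k - j) * (((1 - q ^ j) * u j) * u (Suc k - j))"
    have "(1 - q ^ Suc k) * S (Suc k) = (\<Sum>j\<le>Suc k. ?f j + ?g j)"
      unfolding S_def sum_distrib_left
    proof (rule sum.cong)
      fix j assume "j \<in> {..Suc k}"
      then have "q ^ Suc k = q ^ (Suc k - j) * q ^ j" by (simp flip: power_add)
      then show "(1 - q ^ Suc k) * (a j * (u j * u (Suc k - j))) = ?f j + ?g j"
        by (simp only:) (simp add: algebra_simps)
    qed simp
    also have "\<dots> = (\<Sum>j\<le>Suc k. ?f j) + (\<Sum>j\<le>Suc k. ?g j)"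
      by (rule sum.distrib)
    also have "(\<Sum>j\<le>Suc k. ?f j) = (\<Sum>j\<le>k. ?f j)"
      by simp
    also have "\<dots> = S k"
      unfolding S_def by (rule sum.cong) (simp_all add: Suc_diff_le u_Suc del: power_Suc)
    also have "(\<Sum>j\<le>Suc k. ?g j) = (\<Sum>j\<le>k. ?g (Suc j))"
      by (subst sum.atMost_Suc_shift) simp
    also have "\<dots> = (\<Sum>j\<le>k. - (z * q ^ Suc k) * (a j * (u j * u (k - j))))"
    proof (rule sum.cong)
      fix j assume "j \<in> {..k}"
      then have q: "q ^ Suc k = q ^ (k - j) * q ^ Suc j"
        by (simp flip: power_add del: power_Suc)
      show "?g (Suc j) = - (z * q ^ Suc k) * (a j * (u j * u (k - j)))"
        unfolding q u_Suc a_Suc by (simp add: ac_simps del: power_Suc)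
    qed simp
    also have "\<dots> = - (z * q ^ Suc k) * S k"
      unfolding S_def by (rule sum_distrib_left[symmetric])
    finally show ?thesis by (simp add: algebra_simps)
  qed
  have "q_pochhammer q q k * S k = q_pochhammer (z * q) q k"
  proof (induction k)
    case 0
    show ?case using u[of 0] by (simp add: q_pochhammer_def S_def a_def numeral_2_eq_2)
  next
    case (Suc k)
    have "q_pochhammer q q (Suc k) * S (Suc k) = q_pochhammer q q k * ((1 - q ^ Suc k) * S (Suc k))"
      by (simp add: poch_Suc ac_simps)
    also have "\<dots> = (q_pochhammer q q k * S k) * (1 - z * q ^ Suc k)"
      unfolding step by (simp add: ac_simps)
    also have "\<dots> = q_pochhammer (z * q) q (Suc k)"
      unfolding Suc by (simp add: poch_Suc ac_simps)
    finally show ?case .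
  qed
  then have "q_pochhammer (z * q) q k * u k = (q_pochhammer q q k * u k) * S k"
    by (metis mult.assoc mult.commute)
  then show ?thesis by (simp add: u S_def a_def)
qed

section \<open>Coefficientwise positivity and 1/(q;q)_k\<close>

lemma coeff_ge_0_mult:
  assumes "f \<succeq>\<^sub>q 0" "g \<succeq>\<^sub>q 0"
  shows "f * g \<succeq>\<^sub>q 0"
  using assms by (auto simp: coeff_ge_def fps_mult_nth intro!: sum_nonneg mult_nonneg_nonneg)

lemma coeff_ge_0_prod:
  assumes "\<And>i. i \<in> A \<Longrightarrow> f i \<succeq>\<^sub>q 0"
  shows "prod f A \<succeq>\<^sub>q 0"
  using assms
  by (induction A rule: infinite_finite_induct)
     (auto intro: coeff_ge_0_mult simp: coeff_ge_def[of 1])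

lemma coeff_ge_trans: "F \<succeq>\<^sub>q G \<Longrightarrow> G \<succeq>\<^sub>q H \<Longrightarrow> F \<succeq>\<^sub>q H"
  by (fastforce simp: coeff_ge_def intro: order_trans)

lemma coeff_ge_0_geometric: "inverse (1 - fps_X ^ Suc m) \<succeq>\<^sub>q 0"
proof -
  let ?f = "inverse (1 - fps_X ^ Suc m) :: rat fps"
  have "?f * (1 - fps_X ^ Suc m) = 1"
    by (rule inverse_mult_eq_1) simp
  \<comment> \<open>Read at n, this equation refers back only to the coefficient at n - (m+1), so
    strong induction applies.\<close>
  then have f: "?f = 1 + ?f * fps_X ^ Suc m"
    by (simp add: algebra_simps)
  have "fps_nth ?f n \<ge> 0" for n
  proof (induction n rule: less_induct)
    case (less n)
    have "fps_nth ?f n = fps_nth 1 n + (if n < Suc m then 0 else fps_nth ?f (n - Suc m))"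
      by (subst f) (simp only: fps_add_nth fps_X_power_mult_right_nth)
    then show ?case using less[of "n - Suc m"] by (auto simp del: power_Suc)
  qed
  then show ?thesis by (simp add: coeff_ge_def del: power_Suc)
qed

text \<open>The series 1/(q;q)_k, the generating function of partitions into parts of size at most
  k.\<close>

definition inv_euler :: "nat \<Rightarrow> rat fps" where
  "inv_euler k = (\<Prod>i<k. inverse (1 - fps_X ^ Suc i))"

lemma q_pochhammer_inv_euler: "q_pochhammer fps_X fps_X k * inv_euler k = 1"
proof -
  have "(1 - fps_X ^ Suc i) * inverse (1 - fps_X ^ Suc i) = (1 :: rat fps)" for i
    by (rule inverse_mult_eq_1') simp
  then show ?thesis
    by (simp add: q_pochhammer_def inv_euler_def flip: prod.distrib)
qed

lemma coeff_ge_0_inv_euler: "inv_euler k \<succeq>\<^sub>q 0"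
  unfolding inv_euler_def by (intro coeff_ge_0_prod coeff_ge_0_geometric)

text \<open>The factor 1/(1-q) of the nonempty product cancels, leaving geometric series. Since
  multiplying by 1-q takes differences of coefficients, this yields monotonicity via
  \<open>incseq_fps_nth\<close>.\<close>

lemma coeff_ge_0_one_minus_X_inv_euler: "(1 - fps_X) * inv_euler (Suc k) \<succeq>\<^sub>q 0"
proof -
  have "(1 - fps_X) * inv_euler (Suc k) =
      ((1 - fps_X) * inverse (1 - fps_X)) * (\<Prod>i<k. inverse (1 - fps_X ^ Suc (Suc i)))"
    unfolding inv_euler_def prod.lessThan_Suc_shift by (simp add: mult.assoc)
  also have "(1 - fps_X) * inverse (1 - fps_X) = (1 :: rat fps)"
    by (rule inverse_mult_eq_1') simp
  finally have "(1 - fps_X) * inv_euler (Suc k) = (\<Prod>i<k. inverse (1 - fps_X ^ Suc (Suc i)))"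
    by (simp only: mult_1)
  then show ?thesis
    by (simp only:) (intro coeff_ge_0_prod coeff_ge_0_geometric)
qed

lemma incseq_fps_nth:
  assumes "(1 - fps_X) * f \<succeq>\<^sub>q 0"
  shows "incseq (fps_nth f)"
proof (rule incseq_SucI)
  fix n
  have "fps_nth ((1 - fps_X) * f) (Suc n) \<ge> 0" using assms by (simp add: coeff_ge_def)
  then show "fps_nth f n \<le> fps_nth f (Suc n)" by (simp add: left_diff_distrib)
qed

section \<open>Monomials and the embedding of ordinary power series\<close>

lemma frac_nth_q_powr_mult:
  assumes "\<alpha> \<ge> 0"
  shows "frac_nth (q_powr \<alpha> * F) \<beta> = frac_nth F (\<beta> - \<alpha>)"
proof -
  have "{\<gamma>. frac_nth (q_powr \<alpha>) \<gamma> \<noteq> 0 \<and> frac_nth F (\<beta> - \<gamma>) \<noteq> 0} =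
      (if frac_nth F (\<beta> - \<alpha>) = 0 then {} else {\<alpha>})"
    using assms by (auto simp: q_powr.rep_eq)
  then show ?thesis
    using assms by (simp add: frac_nth_mult q_powr.rep_eq)
qed

lemma q_powr_add:
  assumes "\<alpha> \<ge> 0" "\<beta> \<ge> 0"
  shows "q_powr (\<alpha> + \<beta>) = q_powr \<alpha> * q_powr \<beta>"
  using assms
  by (intro frac_fps_eqI) (auto simp: frac_nth_q_powr_mult q_powr.rep_eq)

lemma q_powr_power:
  assumes "\<alpha> \<ge> 0"
  shows "q_powr \<alpha> ^ n = q_powr (of_nat n * \<alpha>)"
proof (induction n)
  case 0
  show ?case by (rule frac_fps_eqI) (simp add: one_frac_fps.rep_eq q_powr.rep_eq)
next
  case (Suc n)
  then show ?case using assms by (simp add: distrib_right q_powr_add)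
qed

lemma frac_nth_sum: "frac_nth (sum f A) \<alpha> = (\<Sum>i\<in>A. frac_nth (f i) \<alpha>)"
  by (induction A rule: infinite_finite_induct) (simp_all add: frac_nth_add zero_frac_fps.rep_eq)

lemma frac_nth_neg_one_power_mult: "frac_nth ((-1) ^ j * F) \<alpha> = (-1) ^ j * frac_nth F \<alpha>"
  by (induction j) (simp_all add: uminus_frac_fps.rep_eq mult.assoc)

text \<open>\<open>frac_of_fps 1\<close> is a ring homomorphism sending q to
  \<open>q_powr 1\<close>, so inverses found among ordinary series serve in the fractional
  ring.\<close>

lemma q_pochhammer_frac:
  "q_pochhammer (q_powr 1) (q_powr 1) k = frac_of_fps 1 (q_pochhammer fps_X fps_X k)"
proof -
  have pow: "frac_of_fps 1 (f ^ n) = frac_of_fps 1 f ^ n" for f n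
    by (induction n) (simp_all add: frac_of_fps_1 frac_of_fps_mult)
  have sub: "frac_of_fps 1 (g - h) = frac_of_fps 1 g - frac_of_fps 1 h" for g h
    using frac_of_fps_add[of 1 g "- h"] frac_of_fps_uminus[of 1 h] by simp
  show ?thesis
    by (induction k)
       (simp_all add: q_pochhammer_def frac_of_fps_1 frac_of_fps_mult q_powr_1 sub pow
         del: One_nat_def)
qed

section \<open>Expansion of the trace\<close>

text \<open>The coefficients of 1/((q;q)_j (q;q)_(k-j)), taken at rational exponents so that
  negative or fractional ones give 0 without a case distinction.\<close>

definition term_coeff :: "nat \<Rightarrow> nat \<Rightarrow> rat \<Rightarrow> rat" where
  "term_coeff k j = frac_nth (frac_of_fps 1 (inv_euler j * inv_euler (k - j)))"

text \<open>The q-binomial theorem at z = q^r, with each monomial absorbed as a shift of the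
  exponent. The sum keeps all j; discarded terms appear as zero values of
  \<open>term_coeff\<close>.\<close>

lemma T_trace_nth:
  assumes "r \<ge> 0"
  shows "fps_nth (T_trace r k) n =
    (\<Sum>j\<le>k. (-1) ^ j * term_coeff k j (of_nat n - of_nat (Suc j choose 2) - of_nat j * r))"
proof -
  let ?q = "q_powr 1" and ?z = "q_powr r"
  let ?u = "\<lambda>k. frac_of_fps 1 (inv_euler k)"
  have u: "q_pochhammer ?q ?q k * ?u k = 1" for k
    using frac_of_fps_mult[of 1 "q_pochhammer fps_X fps_X k" "inv_euler k"]
    by (simp add: q_pochhammer_frac q_pochhammer_inv_euler frac_of_fps_1)
  have "G_frac r k = q_pochhammer (?z * ?q) ?q k * ?u k"
    using frac_fps_inverse_eqI[OF u] assms
    by (simp add: G_frac_def divide_frac_fps_def q_powr_add)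
  also have "\<dots> = (\<Sum>j\<le>k. (-1) ^ j * ?q ^ (Suc j choose 2) * ?z ^ j * (?u j * ?u (k - j)))"
    by (rule q_binomial_unit[OF u])
  also have "\<dots> = (\<Sum>j\<le>k. (-1) ^ j * (q_powr (of_nat (Suc j choose 2) + of_nat j * r)
      * frac_of_fps 1 (inv_euler j * inv_euler (k - j))))"
    using assms by (simp add: q_powr_power q_powr_add frac_of_fps_mult mult.assoc)
  finally show ?thesis
    using assms unfolding T_trace_def integer_trace_def
    by (simp add: frac_nth_sum frac_nth_neg_one_power_mult frac_nth_q_powr_mult term_coeff_def
        diff_diff_eq)
qed

lemma term_coeff_nat: "term_coeff k j (of_nat i) = fps_nth (inv_euler j * inv_euler (k - j)) i"
  using frac_of_fps_nth[of 1] by (simp add: term_coeff_def)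

lemma term_coeff_eq_0: "\<alpha> \<notin> \<nat> \<Longrightarrow> term_coeff k j \<alpha> = 0"
  unfolding term_coeff_def by (rule frac_of_fps_nth_0) auto

lemma term_coeff_nonneg: "term_coeff k j \<alpha> \<ge> 0"
proof (cases "\<alpha> \<in> \<nat>")
  case True
  then show ?thesis
    using coeff_ge_0_mult[OF coeff_ge_0_inv_euler coeff_ge_0_inv_euler]
    by (auto simp: Nats_def term_coeff_nat coeff_ge_def)
qed (simp add: term_coeff_eq_0)

text \<open>For j \<ge> 1 the factor \<open>inv_euler j\<close> contains 1/(1-q). If \<alpha> is not
  a natural number, the left side is 0; otherwise integrality makes \<beta> a natural number
  too.\<close>

lemma term_coeff_mono:
  assumes "j \<ge> 1" "\<alpha> \<le> \<beta>" "\<beta> \<in> \<int>"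
  shows "term_coeff k j \<alpha> \<le> term_coeff k j \<beta>"
proof (cases "\<alpha> \<in> \<nat>")
  case True
  then obtain a where a: "\<alpha> = of_nat a" by (auto simp: Nats_def)
  with assms(2,3) have "\<beta> \<in> \<nat>" by (auto simp: Nats_altdef2)
  then obtain b where b: "\<beta> = of_nat b" by (auto simp: Nats_def)
  obtain i where i: "j = Suc i" using assms(1) by (cases j) auto
  have "(1 - fps_X) * (inv_euler j * inv_euler (k - j)) \<succeq>\<^sub>q 0"
    unfolding i mult.assoc[symmetric]
    by (intro coeff_ge_0_mult coeff_ge_0_one_minus_X_inv_euler coeff_ge_0_inv_euler)
  then show ?thesis
    using assms(2) a b by (auto simp: term_coeff_nat intro: incseqD[OF incseq_fps_nth])
qed (simp add: term_coeff_eq_0 term_coeff_nonneg)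

lemma term_coeff_shift_eq_0:
  assumes "of_nat j * r \<notin> \<int>"
  shows "term_coeff k j (of_nat n - of_nat t - of_nat j * r) = 0"
proof (rule term_coeff_eq_0)
  show "of_nat n - of_nat t - of_nat j * r \<notin> \<nat>"
  proof
    assume "of_nat n - of_nat t - of_nat j * r \<in> \<nat>"
    then have "of_nat n - of_nat t - (of_nat n - of_nat t - of_nat j * r) \<in> \<int>"
      by (intro Ints_diff) (auto dest: Nats_subset_Ints[THEN subsetD])
    with assms show False by simp
  qed
qed

section \<open>Denominators and \<open>flat\<close>\<close>

lemma den_pos: "den r > 0"
  by (simp add: den_def quotient_of_denom_pos')

lemma den_dvd_iff: "of_int j * r \<in> \<int> \<longleftrightarrow> den r dvd j"
proof -
  obtain a b where ab: "quotient_of r = (a, b)" by force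
  then have b: "b > 0" "coprime a b" "r = of_int a / of_int b"
    by (auto intro: quotient_of_denom_pos quotient_of_coprime quotient_of_div)
  have "of_int j * r = of_int (j * a) / of_int b" using b by simp
  also have "\<dots> \<in> \<int> \<longleftrightarrow> b dvd j * a"
    using b(1) by (simp only: of_int_div_of_int_in_Ints_iff) simp
  also have "\<dots> \<longleftrightarrow> b dvd j"
    using b(2) by (simp add: coprime_dvd_mult_left_iff coprime_commute)
  finally show ?thesis using ab by (simp add: den_def)
qed

lemma of_nat_mult_inverse_in_Ints_iff:
  assumes "b > 0"
  shows "(of_nat j * (1 / of_int b) :: rat) \<in> \<int> \<longleftrightarrow> b dvd int j"
  using assms of_int_div_of_int_in_Ints_iff[of "int j" b, where 'a = rat] by simp

text \<open>\<open>den r * r\<close> is a positive integer, hence at least 1, and the lcm is at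
  least \<open>den r\<close>.\<close>

lemma flat_le:
  assumes "r > 0"
  shows "flat r \<le> r"
proof -
  have den: "of_int (den r) * r \<in> \<int>" by (simp add: den_dvd_iff)
  then obtain a where a: "of_int (den r) * r = of_int a" by (auto elim: Ints_cases)
  have "(0::rat) < of_int (den r) * r" using assms den_pos[of r] by simp
  with a have "a \<ge> 1" by simp
  have "den r \<le> lcm (den r) 2"
    using den_pos[of r] by (intro zdvd_imp_le) (auto simp: lcm_pos_int)
  then have "of_int (den r) * r \<le> of_int (lcm (den r) 2) * r"
    using assms by (intro mult_right_mono) auto
  with a \<open>a \<ge> 1\<close> have "1 \<le> of_int (lcm (den r) 2) * r"
    by (metis of_int_1_le_iff order_trans)
  then show ?thesis
    using den_pos[of r] by (simp add: flat_def field_simps lcm_pos_int)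
qed

lemma flat_eq: obtains m :: nat where "m \<ge> 1" "flat r = 1 / of_nat (2 * m)"
proof -
  obtain l where l: "lcm (den r) 2 = 2 * l" by (metis dvd_def dvd_lcm2)
  moreover have "lcm (den r) 2 > 0" using den_pos[of r] by (simp add: lcm_pos_int)
  ultimately have "l > 0" by simp
  then show ?thesis using that[of "nat l"] l by (simp add: flat_def)
qed

section \<open>Comparing traces term by term\<close>

lemma T_trace_flat_ge:
  assumes r: "r > 0"
  shows "T_trace (flat r) k \<succeq>\<^sub>q T_trace r k"
proof -
  define b where "b = lcm (den r) 2"
  have b: "b > 0" "flat r = 1 / of_int b"
    using den_pos[of r] by (simp_all add: b_def flat_def lcm_pos_int)
  have flat0: "flat r \<ge> 0" using b by simp
  have "(-1) ^ j * term_coeff k j (of_nat n - of_nat (Suc j choose 2) - of_nat j * r) \<le>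
      (-1) ^ j * term_coeff k j (of_nat n - of_nat (Suc j choose 2) - of_nat j * flat r)"
    (is "_ * ?x \<le> _ * ?y") for j n
  proof (cases "even j")
    case True
    \<comment> \<open>j = 0 is separate because \<open>term_coeff_mono\<close> needs j \<ge> 1;
      there both exponents agree.\<close>
    consider "j = 0" | "j > 0" "of_nat j * r \<notin> \<int>" | "j > 0" "of_nat j * r \<in> \<int>" by auto
    then have "?x \<le> ?y"
    proof cases
      case 2
      then show ?thesis by (simp add: term_coeff_shift_eq_0 term_coeff_nonneg)
    next
      case 3
      then have "den r dvd int j" using den_dvd_iff[of "int j" r] by simp
      then have "b dvd int j" using True by (simp add: b_def)
      then have "of_nat j * flat r \<in> \<int>"
        using of_nat_mult_inverse_in_Ints_iff[of b j] b by simp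
      moreover have "of_nat j * flat r \<le> of_nat j * r"
        using flat_le[OF r] by (simp add: mult_left_mono)
      ultimately show ?thesis
        using 3(1) by (intro term_coeff_mono) (auto intro!: Ints_diff)
    qed simp
    then show ?thesis using True by simp
  next
    case False
    \<comment> \<open>\<open>b\<close> is even and so divides no odd j.\<close>
    then have "\<not> b dvd int j"
      unfolding b_def using dvd_trans[OF dvd_lcm2] by fastforce
    then have "of_nat j * flat r \<notin> \<int>"
      using of_nat_mult_inverse_in_Ints_iff[of b j] b by simp
    then have "?y = 0" by (rule term_coeff_shift_eq_0)
    then show ?thesis using False term_coeff_nonneg by simp
  qed
  then show ?thesis
    unfolding coeff_ge_def using r flat0
    by (auto simp: T_trace_nth intro!: sum_mono)
qed

lemma T_trace_half_ge:
  assumes "k < 2 * m"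
  shows "T_trace (1/2) k \<succeq>\<^sub>q T_trace (1 / of_nat (2 * m)) k"
proof -
  have "(-1) ^ j * term_coeff k j (of_nat n - of_nat (Suc j choose 2) - of_nat j * (1 / of_nat (2 * m))) \<le>
      (-1) ^ j * term_coeff k j (of_nat n - of_nat (Suc j choose 2) - of_nat j * (1 / 2))"
    (is "_ * ?x \<le> _ * ?y") if "j \<le> k" for j n
  proof (cases "j = 0")
    case False
    \<comment> \<open>Here 0 < j \<le> k < 2m.\<close>
    then have "\<not> int (2 * m) dvd int j"
      using that assms by (auto dest: zdvd_imp_le)
    then have "of_nat j * (1 / of_nat (2 * m)) \<notin> (\<int> :: rat set)"
      using of_nat_mult_inverse_in_Ints_iff[of "int (2 * m)" j] assms by simp
    then have x: "?x = 0" by (rule term_coeff_shift_eq_0)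
    show ?thesis
    proof (cases "even j")
      case True
      then show ?thesis unfolding x by (simp add: term_coeff_nonneg)
    next
      case False
      then have "of_nat j * (1 / 2) \<notin> (\<int> :: rat set)"
        using of_nat_mult_inverse_in_Ints_iff[of 2 j] by simp
      then have "?y = 0" by (rule term_coeff_shift_eq_0)
      then show ?thesis unfolding x by simp
    qed
  qed simp
  then show ?thesis
    unfolding coeff_ge_def
    by (auto simp: T_trace_nth simp del: of_nat_mult intro!: sum_mono)
qed

theorem theorem1p5:
  shows
    "(\<forall>(r::rat) (k::nat). r > 0 \<longrightarrow> k \<ge> 1 \<longrightarrow> T_trace (flat r) k \<succeq>\<^sub>q T_trace r k)
   \<and> ((\<forall>(r::rat) (k::nat). r > 0 \<longrightarrow> k \<ge> 1 \<longrightarrow> T_trace (1/2) k \<succeq>\<^sub>q T_trace r k)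
      \<longleftrightarrow> (\<forall>(m::nat) (k::nat). m \<ge> 1 \<longrightarrow> k \<ge> 1 \<longrightarrow>
            T_trace (1/2) k \<succeq>\<^sub>q T_trace (1 / of_nat (2 * m)) k))
   \<and> (\<forall>k::nat. k \<ge> 1 \<longrightarrow>
        (\<forall>m::nat. 2 \<le> m \<longrightarrow> m \<le> k div 2 \<longrightarrow>
            T_trace (1/2) k \<succeq>\<^sub>q T_trace (1 / of_nat (2 * m)) k) \<longrightarrow>
        (\<forall>m::nat. m \<ge> 1 \<longrightarrow> T_trace (1/2) k \<succeq>\<^sub>q T_trace (1 / of_nat (2 * m)) k))"
proof (intro conjI allI impI iffI)
  show "T_trace (flat r) k \<succeq>\<^sub>q T_trace r k" if "r > 0" for r k
    using that by (rule T_trace_flat_ge)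
  show "T_trace (1/2) k \<succeq>\<^sub>q T_trace (1 / of_nat (2 * m)) k"
    if "\<forall>r k. r > 0 \<longrightarrow> k \<ge> 1 \<longrightarrow> T_trace (1/2) k \<succeq>\<^sub>q T_trace r k" "m \<ge> 1" "k \<ge> 1" for m k
    using that by simp
  show "T_trace (1/2) k \<succeq>\<^sub>q T_trace r k"
    if *: "\<forall>m k. m \<ge> 1 \<longrightarrow> k \<ge> 1 \<longrightarrow> T_trace (1/2) k \<succeq>\<^sub>q T_trace (1 / of_nat (2 * m)) k"
      and "r > 0" "k \<ge> 1" for r k
  proof -
    \<comment> \<open>\<open>flat r\<close> belongs to the family 1/(2m), so it links 1/2 to r by
      transitivity.\<close>
    obtain m where "m \<ge> 1" "flat r = 1 / of_nat (2 * m)" by (rule flat_eq)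
    then have "T_trace (1/2) k \<succeq>\<^sub>q T_trace (flat r) k" using * \<open>k \<ge> 1\<close> by metis
    then show ?thesis using T_trace_flat_ge[OF \<open>r > 0\<close>] by (rule coeff_ge_trans)
  qed
  show "T_trace (1/2) k \<succeq>\<^sub>q T_trace (1 / of_nat (2 * m)) k"
    if *: "\<forall>m. 2 \<le> m \<longrightarrow> m \<le> k div 2 \<longrightarrow> T_trace (1/2) k \<succeq>\<^sub>q T_trace (1 / of_nat (2 * m)) k"
      and "m \<ge> 1" for k m
  proof -
    \<comment> \<open>Beyond \<open>k div 2\<close> one has k < 2m, where the comparison is
      unconditional; at m = 1 the two traces coincide.\<close>
    consider "m = 1" | "2 \<le> m" "m \<le> k div 2" | "k < 2 * m" using \<open>m \<ge> 1\<close> by linarith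
    then show ?thesis
    proof cases
      case 1
      then show ?thesis by (simp add: coeff_ge_def)
    next
      case 2
      then show ?thesis using * by blast
    next
      case 3
      then show ?thesis by (rule T_trace_half_ge)
    qed
  qed
qed

end
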